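(* Let $S$ be an idempotent-free right commutative right cancellative semigroup and let $P$ be a choice function on the collection of all $\theta_S$-classes of $S$. Then the Rees matrix semigroup $\mathcal{M}(S;S/\theta_S;P)$ can be embedded in an idempotent-free left simple semigroup.
   Context: A semigroup is right commutative if it satisfies the identity $axy=ayx$. A semigroup is idempotent-free if it contains no element $e$ with $e^2=e$. A semigroup is left simple if it has no proper left ideal. For a semigroup $S$, $\theta_S$ is the congruence $\theta_S=\{(a,b)\in S\times S: xa=xb \text{ for all } x\in S\}$. For a semigroup $S$, a nonempty set $\Lambda$ and a mapping $P:\Lambda\to S$, $\mathcal{M}(S;\Lambda;P)$ denotes the Rees matrix semigroup whose underlying set is $S\times\Lambda$, with multiplication $(s,\lambda)(t,\mu)=(sP(\lambda)t,\mu)$. A choice function on the collection of all $\theta_S$-classes of $S$ is a mapping $P:S/\theta_S\to S$ with $P([s]_{\theta_S})\in[s]_{\theta_S}$ for every $s\in S$. *)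

theory Defs
  imports Main
begin

text \<open>A semigroup is given by a nonempty carrier set together with a binary operation on the
  ambient type, of which only the values on the carrier matter.\<close>

definition semigroup_on :: "'a set \<Rightarrow> ('a \<Rightarrow> 'a \<Rightarrow> 'a) \<Rightarrow> bool" where
  "semigroup_on S f \<longleftrightarrow> S \<noteq> {} \<and> (\<forall>x\<in>S. \<forall>y\<in>S. f x y \<in> S) \<and>
     (\<forall>x\<in>S. \<forall>y\<in>S. \<forall>z\<in>S. f (f x y) z = f x (f y z))"

definition right_commutative_on :: "'a set \<Rightarrow> ('a \<Rightarrow> 'a \<Rightarrow> 'a) \<Rightarrow> bool" where
  "right_commutative_on S f \<longleftrightarrow> (\<forall>a\<in>S. \<forall>x\<in>S. \<forall>y\<in>S. f (f a x) y = f (f a y) x)"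

definition right_cancellative_on :: "'a set \<Rightarrow> ('a \<Rightarrow> 'a \<Rightarrow> 'a) \<Rightarrow> bool" where
  "right_cancellative_on S f \<longleftrightarrow> (\<forall>a\<in>S. \<forall>b\<in>S. \<forall>x\<in>S. f a x = f b x \<longrightarrow> a = b)"

definition idempotent_free_on :: "'a set \<Rightarrow> ('a \<Rightarrow> 'a \<Rightarrow> 'a) \<Rightarrow> bool" where
  "idempotent_free_on S f \<longleftrightarrow> \<not> (\<exists>e\<in>S. f e e = e)"

definition left_ideal_on :: "'a set \<Rightarrow> ('a \<Rightarrow> 'a \<Rightarrow> 'a) \<Rightarrow> 'a set \<Rightarrow> bool" where
  "left_ideal_on S f L \<longleftrightarrow> L \<noteq> {} \<and> L \<subseteq> S \<and> (\<forall>s\<in>S. \<forall>x\<in>L. f s x \<in> L)"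

definition left_simple_on :: "'a set \<Rightarrow> ('a \<Rightarrow> 'a \<Rightarrow> 'a) \<Rightarrow> bool" where
  "left_simple_on S f \<longleftrightarrow> \<not> (\<exists>L. left_ideal_on S f L \<and> L \<noteq> S)"

definition theta :: "'a set \<Rightarrow> ('a \<Rightarrow> 'a \<Rightarrow> 'a) \<Rightarrow> ('a \<times> 'a) set" where
  "theta S f = {(a, b). a \<in> S \<and> b \<in> S \<and> (\<forall>x\<in>S. f x a = f x b)}"

definition choice_function_on :: "'a set set \<Rightarrow> ('a set \<Rightarrow> 'a) \<Rightarrow> bool" where
  "choice_function_on \<C> P \<longleftrightarrow> (\<forall>C\<in>\<C>. P C \<in> C)"

definition rees_carrier :: "'a set \<Rightarrow> 'l set \<Rightarrow> ('a \<times> 'l) set" where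
  "rees_carrier S \<Lambda> = S \<times> \<Lambda>"

fun rees_mult :: "('a \<Rightarrow> 'a \<Rightarrow> 'a) \<Rightarrow> ('l \<Rightarrow> 'a) \<Rightarrow> 'a \<times> 'l \<Rightarrow> 'a \<times> 'l \<Rightarrow> 'a \<times> 'l" where
  "rees_mult f P (s, l) (t, m) = (f (f s (P l)) t, m)"

text \<open>HOL cannot quantify existentially over types, so an assertion that a semigroup embeds in
  some semigroup with given properties has to name the type \<open>'b\<close> of the latter. Taking it to be the
  type of self-maps of the type of the former only bounds the cardinality: the operation on it
  is arbitrary and need not be composition.\<close>

definition embeds_in ::
  "'a set \<Rightarrow> ('a \<Rightarrow> 'a \<Rightarrow> 'a) \<Rightarrow> 'b set \<Rightarrow> ('b \<Rightarrow> 'b \<Rightarrow> 'b) \<Rightarrow> bool" where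
  "embeds_in S f T g \<longleftrightarrow> (\<exists>\<phi>. \<phi> ` S \<subseteq> T \<and> inj_on \<phi> S \<and>
     (\<forall>x\<in>S. \<forall>y\<in>S. \<phi> (f x y) = g (\<phi> x) (\<phi> y)))"

lemma equiv_theta: "equiv S (theta S f)"
  by (rule equivI) (auto simp: theta_def refl_on_def sym_def trans_def)

lemma theta_congruence:
  assumes "semigroup_on S f" "(a, b) \<in> theta S f" "(c, d) \<in> theta S f"
  shows "(f a c, f b d) \<in> theta S f"
proof -
  have cl: "\<forall>x\<in>S. \<forall>y\<in>S. f x y \<in> S"
    and as: "\<And>x y z. x \<in> S \<Longrightarrow> y \<in> S \<Longrightarrow> z \<in> S \<Longrightarrow> f x (f y z) = f (f x y) z"
    using assms(1) by (auto simp: semigroup_on_def)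
  have mem: "a \<in> S" "b \<in> S" "c \<in> S" "d \<in> S"
    and ab: "\<And>x. x \<in> S \<Longrightarrow> f x a = f x b" and cd: "\<And>x. x \<in> S \<Longrightarrow> f x c = f x d"
    using assms(2,3) by (auto simp: theta_def)
  have "f x (f a c) = f x (f b d)" if "x \<in> S" for x
    using that mem cl by (simp add: as ab cd)
  then show ?thesis
    using assms by (simp add: semigroup_on_def theta_def)
qed

lemma semigroup_on_rees:
  assumes "semigroup_on S f" "\<Lambda> \<noteq> {}" "P ` \<Lambda> \<subseteq> S"
  shows "semigroup_on (rees_carrier S \<Lambda>) (rees_mult f P)"
  using assms by (auto simp: semigroup_on_def rees_carrier_def image_subset_iff)

end

theory Submission
  imports Defs
begin

text \<open>
  Let \<open>C = S / \<theta>\<close>. Right commutativity makes \<open>C\<close> commutative, and together with right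
  cancellation it makes \<open>C\<close> cancellative; since \<open>S\<close> has no idempotent, neither has \<open>C\<close>
  (lemma \<open>square_not_theta\<close>). A product \<open>s t\<close> depends only on \<open>s\<close> and the class of \<open>t\<close>, so \<open>S\<close> is
  a set on which \<open>C\<close> acts freely from the right, with an equivariant map to \<open>C\<close>. An element of \<open>S\<close>
  is therefore determined by its class in \<open>C\<close> and its orbit, where \<open>s\<close> and \<open>t\<close> share an orbit when
  \<open>s x = t y\<close> for some \<open>x\<close>, \<open>y\<close> (lemma \<open>orbit_theta_eq\<close>). Under multiplication, classes are
  multiplied and the orbit is that of the left factor.

  As \<open>P l\<close> lies in the class \<open>l\<close>, the map sending \<open>(s, l)\<close> to the triple of the class of \<open>s P l\<close>,
  the index \<open>l\<close> and the orbit of \<open>s\<close> is an embedding of the Rees matrix semigroup in the direct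
  product of \<open>K\<close> and a left zero semigroup, where \<open>K = C \<times> C\<close> with \<open>(u, l) (v, m) = (u v, m)\<close> is
  left cancellative and idempotent-free.

  Any left cancellative idempotent-free semigroup \<open>K\<close> acts faithfully on itself with an identity
  adjoined by injections that miss the identity. With enough copies of this action the injections
  miss a set as large as the whole, and such injections form the Baer-Levi semigroup
  (lemma \<open>left_cancellative_embeds_baer_levi\<close>), which is left simple and idempotent-free. The
  direct product of a Baer-Levi semigroup with a left zero semigroup inherits both properties.
  Its elements can be taken to be maps \<open>map_prod f (\<lambda>_. X)\<close>, because
  composing these multiplies the first components and keeps the left constant.
\<close>

section \<open>Baer-Levi semigroups\<close>

text \<open>The condition on \<open>j\<close> says that the complement of the range of \<open>f\<close> has the cardinality of
  the whole type. A witnessing injection serves better than a statement about cardinals, because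
  the constructions below compose such witnesses.\<close>

definition baer_levi :: "('w \<Rightarrow> 'w) set" where
  "baer_levi = {f. inj f \<and> (\<exists>j :: 'w \<Rightarrow> 'w. inj j \<and> range j \<inter> range f = {})}"

lemma baer_leviI:
  fixes f j :: "'w \<Rightarrow> 'w"
  assumes "inj f" "inj j" "\<And>x y. j x \<noteq> f y"
  shows "f \<in> baer_levi"
  using assms unfolding baer_levi_def by blast

lemma baer_leviE:
  fixes f :: "'w \<Rightarrow> 'w"
  assumes "f \<in> baer_levi"
  obtains j :: "'w \<Rightarrow> 'w" where "inj f" "inj j" "\<forall>x y. j x \<noteq> f y"
  using assms unfolding baer_levi_def by blast

lemma baer_levi_comp:
  fixes f g :: "'w \<Rightarrow> 'w"
  assumes "f \<in> baer_levi" "g \<in> baer_levi"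
  shows "f \<circ> g \<in> baer_levi"
proof -
  obtain j :: "'w \<Rightarrow> 'w" where j: "inj f" "inj j" "\<forall>x y. j x \<noteq> f y" using assms(1) by (rule baer_leviE)
  have "inj g" using assms(2) by (rule baer_leviE)
  then show ?thesis using j by (intro baer_leviI[of _ j]) (auto intro: inj_compose)
qed

lemma baer_levi_not_idempotent:
  fixes f :: "'w \<Rightarrow> 'w"
  assumes "f \<in> baer_levi"
  shows "f \<circ> f \<noteq> f"
proof
  assume idem: "f \<circ> f = f"
  obtain j :: "'w \<Rightarrow> 'w" where j: "inj f" "inj j" "\<forall>x y. j x \<noteq> f y" using assms by (rule baer_leviE)
  have "f x = x" for x using idem j(1) by (metis comp_apply injD)
  then show False using j(3) by metis
qed

text \<open>The equation \<open>h \<circ> f = g\<close> prescribes \<open>h\<close> on the range of \<open>f\<close> only. Half of the complement of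
  the range of \<open>g\<close> has room for the values of \<open>h\<close> elsewhere, and the other half stays free. The
  two injections \<open>p\<close> and \<open>q\<close> provide this halving.\<close>

lemma baer_levi_left_divisible:
  fixes f g p q :: "'w \<Rightarrow> 'w"
  assumes pq: "inj p" "inj q" "\<And>x y. p x \<noteq> q y"
    and f: "f \<in> baer_levi" and g: "g \<in> baer_levi"
  shows "\<exists>h\<in>baer_levi. h \<circ> f = g"
proof -
  have injf: "inj f" using f by (rule baer_leviE)
  obtain j :: "'w \<Rightarrow> 'w" where j: "inj g" "inj j" "\<forall>x y. j x \<noteq> g y" using g by (rule baer_leviE)
  define h where "h w = (if w \<in> range f then g (inv f w) else j (p w))" for w
  have h_f: "h (f x) = g x" for x by (simp add: h_def injf)
  have h_off: "h w = j (p w)" if "w \<notin> range f" for w using that by (simp add: h_def)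
  have "inj h"
  proof (rule injI)
    fix x y assume eq: "h x = h y"
    consider x' y' where "x = f x'" "y = f y'" | x' where "x = f x'" "y \<notin> range f"
      | y' where "y = f y'" "x \<notin> range f" | "x \<notin> range f" "y \<notin> range f" by blast
    then show "x = y"
    proof cases
      case 1 then show ?thesis using eq j(1) by (simp add: h_f inj_eq)
    next
      case 2 then show ?thesis using eq j(3) by (metis h_f h_off)
    next
      case 3 then show ?thesis using eq j(3) by (metis h_f h_off)
    next
      case 4 then show ?thesis using eq j(2) pq(1) by (simp add: h_off inj_eq)
    qed
  qed
  moreover have "inj (j \<circ> q)" using j(2) pq(2) by (rule inj_compose)
  moreover have "(j \<circ> q) x \<noteq> h y" for x y
  proof (cases "y \<in> range f")
    case True then show ?thesis using j(3) by (auto simp: h_f)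
  next
    case False then show ?thesis using j(2) pq(3)[of y x] by (auto simp: h_off inj_eq)
  qed
  ultimately have "h \<in> baer_levi" by (rule baer_leviI)
  moreover have "h \<circ> f = g" by (auto simp: h_f)
  ultimately show ?thesis by blast
qed

section \<open>Left cancellative semigroups inside Baer-Levi semigroups\<close>

definition left_cancellative_on :: "'k set \<Rightarrow> ('k \<Rightarrow> 'k \<Rightarrow> 'k) \<Rightarrow> bool" where
  "left_cancellative_on K m \<longleftrightarrow> (\<forall>a\<in>K. \<forall>b\<in>K. \<forall>c\<in>K. m a b = m a c \<longrightarrow> b = c)"

text \<open>Left multiplication by \<open>a\<close> in the semigroup with an identity \<open>None\<close> adjoined. Elements of
  the type outside the carrier are left alone, which keeps the map injective.\<close>

definition left_translation :: "'k set \<Rightarrow> ('k \<Rightarrow> 'k \<Rightarrow> 'k) \<Rightarrow> 'k \<Rightarrow> 'k option \<Rightarrow> 'k option" where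
  "left_translation K m a z =
     (case z of None \<Rightarrow> Some a | Some k \<Rightarrow> if k \<in> K then Some (m a k) else Some k)"

text \<open>The adjoined identity is the only obstacle to injectivity: if \<open>a k = a\<close>, then
  \<open>a k k = a k\<close>, and \<open>k\<close> would be idempotent by cancellation.\<close>

lemma inj_left_translation:
  assumes K: "semigroup_on K m" and free: "idempotent_free_on K m"
    and canc: "left_cancellative_on K m" and a: "a \<in> K"
  shows "inj (left_translation K m a)"
proof -
  have cl: "m x y \<in> K" if "x \<in> K" "y \<in> K" for x y using K that by (auto simp: semigroup_on_def)
  have as: "m (m x y) z = m x (m y z)" if "x \<in> K" "y \<in> K" "z \<in> K" for x y z
    using K that by (auto simp: semigroup_on_def)
  have canc: "m a x = m a y \<longleftrightarrow> x = y" if "x \<in> K" "y \<in> K" for x y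
    using canc a that unfolding left_cancellative_on_def by blast
  have fixed: "m a k \<noteq> a" if k: "k \<in> K" for k
  proof
    assume "m a k = a"
    then have "m a (m k k) = m a k" using as[OF a k k] by simp
    then have "m k k = k" using canc[OF cl[OF k k] k] by simp
    then show False using free k unfolding idempotent_free_on_def by blast
  qed
  show ?thesis
  proof (rule injI)
    fix y z assume "left_translation K m a y = left_translation K m a z"
    then show "y = z"
      using a canc fixed fixed[symmetric] cl[OF a]
      by (cases y; cases z) (auto simp: left_translation_def split: if_splits)
  qed
qed

lemma left_translation_mult:
  assumes "semigroup_on K m" "a \<in> K" "b \<in> K"
  shows "left_translation K m (m a b) z = left_translation K m a (left_translation K m b z)"
  using assms by (auto simp: left_translation_def semigroup_on_def split: option.splits)

text \<open>The type \<open>'w\<close> contains, along \<open>e\<close>, one copy of the left regular action for each of its own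
  elements. The copies of the adjoined identity are never hit, and there are as many of them as
  there are elements of \<open>'w\<close>.\<close>

lemma left_cancellative_embeds_baer_levi:
  fixes e :: "'k option \<times> 'w \<Rightarrow> 'w"
  assumes e: "inj e"
    and K: "semigroup_on K m" and free: "idempotent_free_on K m"
    and canc: "left_cancellative_on K m"
  shows "\<exists>\<psi> :: 'k \<Rightarrow> 'w \<Rightarrow> 'w. \<psi> ` K \<subseteq> baer_levi \<and> inj_on \<psi> K \<and>
    (\<forall>a\<in>K. \<forall>b\<in>K. \<psi> (m a b) = \<psi> a \<circ> \<psi> b)"
proof -
  define act where "act a = map_prod (left_translation K m a) (id :: 'w \<Rightarrow> 'w)" for a
  define \<psi> where "\<psi> a w = (if w \<in> range e then e (act a (inv e w)) else w)" for a w
  have on: "\<psi> a (e z) = e (act a z)" for a z by (simp add: \<psi>_def e)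
  have off: "\<psi> a w = w" if "w \<notin> range e" for a w using that by (simp add: \<psi>_def)
  have "\<psi> a \<in> baer_levi" if a: "a \<in> K" for a
  proof (rule baer_leviI)
    have "inj (act a)"
      using inj_left_translation[OF K free canc a] by (simp add: act_def prod.inj_map)
    then have act_iff: "act a z = act a z' \<longleftrightarrow> z = z'" for z z' by (simp add: inj_eq)
    show "inj (\<psi> a)"
    proof (rule injI)
      fix x y assume "\<psi> a x = \<psi> a y"
      then show "x = y"
        by (cases "x \<in> range e"; cases "y \<in> range e")
          (auto simp: on off act_iff inj_eq[OF e])
    qed
    show "inj (\<lambda>w. e (None, w))" using e by (auto simp: inj_def)
    show "e (None, x) \<noteq> \<psi> a y" for x y
    proof (cases "y \<in> range e")
      case True
      have "act a z \<noteq> (None, x)" for z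
        by (cases z) (auto simp: act_def left_translation_def split: option.splits)
      then show ?thesis using True by (auto simp: on inj_eq[OF e] eq_commute[of "(None, x)"])
    next
      case False then show ?thesis by (auto simp: off)
    qed
  qed
  moreover have "inj_on \<psi> K"
  proof (rule inj_onI)
    fix a b assume "\<psi> a = \<psi> b"
    \<comment> \<open>The translations by \<open>a\<close> and \<open>b\<close> already differ at the adjoined identity.\<close>
    then have "\<psi> a (e (None, w)) = \<psi> b (e (None, w))" for w by simp
    then show "a = b" using e by (simp add: on act_def left_translation_def inj_eq)
  qed
  moreover have "\<psi> (m a b) = \<psi> a \<circ> \<psi> b" if "a \<in> K" "b \<in> K" for a b
  proof
    fix w
    have "act (m a b) z = act a (act b z)" for z
      using left_translation_mult[OF K that] by (cases z) (simp add: act_def)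
    then show "\<psi> (m a b) w = (\<psi> a \<circ> \<psi> b) w"
      by (cases "w \<in> range e") (auto simp: on off)
  qed
  ultimately show ?thesis by blast
qed

section \<open>Direct products with left zero semigroups\<close>

definition baer_levi_left_zero :: "'i set \<Rightarrow> ('w \<times> 'i \<Rightarrow> 'w \<times> 'i) set" where
  "baer_levi_left_zero I = {map_prod f (\<lambda>_. i) | f i. f \<in> baer_levi \<and> i \<in> I}"

lemma baer_levi_left_zeroE:
  assumes "u \<in> baer_levi_left_zero I"
  obtains f i where "u = map_prod f (\<lambda>_. i)" "f \<in> baer_levi" "i \<in> I"
  using assms unfolding baer_levi_left_zero_def by blast

lemma comp_map_prod_const:
  "map_prod f (\<lambda>_. i) \<circ> map_prod g (\<lambda>_. j) = map_prod (f \<circ> g) (\<lambda>_. i)"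
  by auto

lemma map_prod_const_eq_iff:
  "map_prod f (\<lambda>_. i) = map_prod g (\<lambda>_. j) \<longleftrightarrow> f = g \<and> i = j"
  by (auto simp: fun_eq_iff)

lemma semigroup_baer_levi_left_zero:
  fixes f :: "'w \<Rightarrow> 'w" and i :: 'i
  assumes "f \<in> baer_levi" "i \<in> I"
  shows "semigroup_on (baer_levi_left_zero I :: ('w \<times> 'i \<Rightarrow> 'w \<times> 'i) set) (\<circ>)"
proof -
  have "map_prod f (\<lambda>_. i) \<in> baer_levi_left_zero I"
    using assms by (auto simp: baer_levi_left_zero_def)
  moreover have "u \<circ> v \<in> baer_levi_left_zero I"
    if u: "u \<in> baer_levi_left_zero I" and v: "v \<in> baer_levi_left_zero I"
    for u v :: "'w \<times> 'i \<Rightarrow> 'w \<times> 'i"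
  proof -
    obtain g j where g: "u = map_prod g (\<lambda>_. j)" "g \<in> baer_levi" "j \<in> I"
      using u by (rule baer_levi_left_zeroE)
    obtain h k where h: "v = map_prod h (\<lambda>_. k)" "h \<in> baer_levi"
      using v by (rule baer_levi_left_zeroE)
    have "g \<circ> h \<in> baer_levi" using g(2) h(2) by (rule baer_levi_comp)
    then show ?thesis
      unfolding g(1) h(1) comp_map_prod_const baer_levi_left_zero_def using g(3) by blast
  qed
  ultimately show ?thesis unfolding semigroup_on_def comp_assoc by blast
qed

lemma idempotent_free_baer_levi_left_zero:
  "idempotent_free_on (baer_levi_left_zero I) (\<circ>)"
proof -
  have "u \<circ> u \<noteq> u" if u: "u \<in> baer_levi_left_zero I" for u
  proof -
    obtain f i where f: "u = map_prod f (\<lambda>_. i)" "f \<in> baer_levi"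
      using u by (rule baer_levi_left_zeroE)
    show ?thesis
      unfolding f(1) comp_map_prod_const map_prod_const_eq_iff
      using baer_levi_not_idempotent[OF f(2)] by blast
  qed
  then show ?thesis unfolding idempotent_free_on_def by blast
qed

text \<open>The left factor alone decides the constant, so dividing by \<open>map_prod f (\<lambda>_. i)\<close> reduces to
  dividing by \<open>f\<close> in the Baer-Levi semigroup.\<close>

lemma left_simple_baer_levi_left_zero:
  fixes p q :: "'w \<Rightarrow> 'w" and I :: "'i set"
  assumes pq: "inj p" "inj q" "\<And>x y. p x \<noteq> q y"
  shows "left_simple_on (baer_levi_left_zero I :: ('w \<times> 'i \<Rightarrow> 'w \<times> 'i) set) (\<circ>)"
proof -
  have mem: "v \<in> L" if L: "left_ideal_on (baer_levi_left_zero I) (\<circ>) L"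
    and v: "v \<in> baer_levi_left_zero I" for L and v :: "'w \<times> 'i \<Rightarrow> 'w \<times> 'i"
  proof -
    obtain u where u: "u \<in> L" "u \<in> baer_levi_left_zero I"
      using L unfolding left_ideal_on_def by blast
    obtain f i where f: "u = map_prod f (\<lambda>_. i)" "f \<in> baer_levi"
      using u(2) by (rule baer_levi_left_zeroE)
    obtain g j where g: "v = map_prod g (\<lambda>_. j)" "g \<in> baer_levi" "j \<in> I"
      using v by (rule baer_levi_left_zeroE)
    obtain h where h: "h \<in> baer_levi" "h \<circ> f = g"
      using baer_levi_left_divisible[OF pq f(2) g(2)] by blast
    have "map_prod h (\<lambda>_. j) \<in> baer_levi_left_zero I"
      using h g by (auto simp: baer_levi_left_zero_def)
    then have "map_prod h (\<lambda>_. j) \<circ> u \<in> L" using L u(1) unfolding left_ideal_on_def by blast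
    then show ?thesis by (simp only: f g comp_map_prod_const h)
  qed
  have "L = baer_levi_left_zero I" if L: "left_ideal_on (baer_levi_left_zero I) (\<circ>) L"
    for L :: "('w \<times> 'i \<Rightarrow> 'w \<times> 'i) set"
  proof
    show "L \<subseteq> baer_levi_left_zero I" using L unfolding left_ideal_on_def by (elim conjE)
    show "baer_levi_left_zero I \<subseteq> L" by (intro subsetI mem[OF L])
  qed
  then show ?thesis unfolding left_simple_on_def by blast
qed

section \<open>Right commutative right cancellative semigroups\<close>

locale rc_semigroup =
  fixes S :: "'a set" and f :: "'a \<Rightarrow> 'a \<Rightarrow> 'a"
  assumes semigroup: "semigroup_on S f"
    and idem_free: "idempotent_free_on S f"
    and right_comm: "right_commutative_on S f"
    and right_canc: "right_cancellative_on S f"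
begin

abbreviation mult :: "'a \<Rightarrow> 'a \<Rightarrow> 'a" (infixl \<open>\<cdot>\<close> 70) where "x \<cdot> y \<equiv> f x y"

lemma closed [simp]: "x \<in> S \<Longrightarrow> y \<in> S \<Longrightarrow> x \<cdot> y \<in> S"
  using semigroup by (auto simp: semigroup_on_def)

lemma assoc: "x \<in> S \<Longrightarrow> y \<in> S \<Longrightarrow> z \<in> S \<Longrightarrow> x \<cdot> y \<cdot> z = x \<cdot> (y \<cdot> z)"
  using semigroup by (auto simp: semigroup_on_def)

lemma comm: "x \<in> S \<Longrightarrow> y \<in> S \<Longrightarrow> z \<in> S \<Longrightarrow> x \<cdot> y \<cdot> z = x \<cdot> z \<cdot> y"
  using right_comm by (auto simp: right_commutative_on_def)

lemma cancel: "a \<cdot> x = b \<cdot> x \<Longrightarrow> a \<in> S \<Longrightarrow> b \<in> S \<Longrightarrow> x \<in> S \<Longrightarrow> a = b"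
  using right_canc by (auto simp: right_cancellative_on_def)

text \<open>On a finite carrier the injective map \<open>x \<mapsto> x a\<close> would be onto; a solution of \<open>e a = a\<close>
  satisfies \<open>e e a = e a\<close> and is idempotent.\<close>

lemma infinite_carrier: "infinite S"
proof
  assume fin: "finite S"
  obtain a where a: "a \<in> S" using semigroup by (auto simp: semigroup_on_def)
  have "inj_on (\<lambda>x. x \<cdot> a) S" using a by (auto intro!: inj_onI dest: cancel)
  moreover have "(\<lambda>x. x \<cdot> a) ` S \<subseteq> S" using a by auto
  ultimately have "(\<lambda>x. x \<cdot> a) ` S = S" using fin endo_inj_surj by blast
  then obtain e where e: "e \<in> S" "e \<cdot> a = a" using a by (metis imageE)
  have "e \<cdot> e \<cdot> a = e \<cdot> a" using e a by (simp add: assoc)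
  then have "e \<cdot> e = e" by (rule cancel) (use e(1) a in auto)
  then show False using idem_free e by (auto simp: idempotent_free_on_def)
qed

text \<open>Equality of \<open>a x\<close> and \<open>a y\<close> carries over to every other left factor:
  \<open>b x a = b a x = b a y = b y a\<close>, and \<open>a\<close> cancels.\<close>

lemma left_eq_imp_theta:
  assumes "a \<cdot> x = a \<cdot> y" "a \<in> S" "x \<in> S" "y \<in> S"
  shows "(x, y) \<in> theta S f"
proof -
  have "b \<cdot> x = b \<cdot> y" if b: "b \<in> S" for b
  proof (rule cancel)
    have "b \<cdot> x \<cdot> a = b \<cdot> (a \<cdot> x)" using assms b by (metis assoc comm)
    also have "\<dots> = b \<cdot> y \<cdot> a" using assms b by (metis assoc comm)
    finally show "b \<cdot> x \<cdot> a = b \<cdot> y \<cdot> a" .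
  qed (use assms b in auto)
  then show ?thesis using assms by (auto simp: theta_def)
qed

text \<open>The next two lemmas say that \<open>C\<close> is cancellative.\<close>

lemma theta_left_cancel:
  assumes "(c \<cdot> x, c \<cdot> y) \<in> theta S f" "c \<in> S" "x \<in> S" "y \<in> S"
  shows "(x, y) \<in> theta S f"
proof (rule left_eq_imp_theta)
  show "c \<cdot> c \<cdot> x = c \<cdot> c \<cdot> y" using assms by (simp add: theta_def assoc)
qed (use assms in auto)

lemma theta_right_cancel:
  assumes "(x \<cdot> c, y \<cdot> c) \<in> theta S f" "c \<in> S" "x \<in> S" "y \<in> S"
  shows "(x, y) \<in> theta S f"
proof (rule left_eq_imp_theta)
  have "c \<cdot> x \<cdot> c = c \<cdot> y \<cdot> c" using assms by (simp add: theta_def assoc)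
  then show "c \<cdot> x = c \<cdot> y" using assms cancel by simp
qed (use assms in auto)

lemma square_not_theta:
  assumes "a \<in> S"
  shows "(a \<cdot> a, a) \<notin> theta S f"
proof
  assume "(a \<cdot> a, a) \<in> theta S f"
  then have "a \<cdot> a \<cdot> a = a \<cdot> a" using assms by (simp add: theta_def assoc)
  then have "a \<cdot> a = a" using assms cancel by simp
  then show False using idem_free assms by (auto simp: idempotent_free_on_def)
qed

text \<open>Two elements share an orbit when \<open>C\<close> moves them to a common element. This is the trace
  on \<open>S\<close> of the orbits of the group of fractions of \<open>C\<close>.\<close>

definition orbit :: "'a \<Rightarrow> 'a set" where
  "orbit s = {t \<in> S. \<exists>x\<in>S. \<exists>y\<in>S. s \<cdot> x = t \<cdot> y}"

lemma orbit_self: "s \<in> S \<Longrightarrow> s \<in> orbit s"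
  by (auto simp: orbit_def)

text \<open>That \<open>t\<close> keeps sharing an orbit with \<open>s\<close> after \<open>s\<close> is multiplied by \<open>v\<close> is where right
  commutativity enters: \<open>s x = t y\<close> gives \<open>s v x = s x v = t y v\<close>.\<close>

lemma orbit_mult:
  assumes s: "s \<in> S" and v: "v \<in> S"
  shows "orbit (s \<cdot> v) = orbit s"
proof (intro set_eqI iffI)
  fix t assume "t \<in> orbit (s \<cdot> v)"
  then obtain x y where "t \<in> S" "x \<in> S" "y \<in> S" "s \<cdot> (v \<cdot> x) = t \<cdot> y"
    using s v by (auto simp: orbit_def assoc)
  moreover have "v \<cdot> x \<in> S" using v \<open>x \<in> S\<close> by simp
  ultimately show "t \<in> orbit s" unfolding orbit_def by blast
next
  fix t assume "t \<in> orbit s"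
  then obtain x y where t: "t \<in> S" "x \<in> S" "y \<in> S" "s \<cdot> x = t \<cdot> y" by (auto simp: orbit_def)
  have "s \<cdot> v \<cdot> x = t \<cdot> y \<cdot> v" using s v t by (simp add: comm[of s v])
  also have "\<dots> = t \<cdot> (y \<cdot> v)" using v t by (simp add: assoc)
  finally have "s \<cdot> v \<cdot> x = t \<cdot> (y \<cdot> v)" .
  moreover have "y \<cdot> v \<in> S" using t v by simp
  ultimately show "t \<in> orbit (s \<cdot> v)" unfolding orbit_def using t by blast
qed

text \<open>If \<open>s x = t y\<close> with \<open>s\<close> and \<open>t\<close> in one class, then \<open>s s x = s t y = s s y\<close>, so
  \<open>x\<close> and \<open>y\<close> are in one class as well. Hence \<open>s x = t y = t x\<close>, and \<open>x\<close> cancels.\<close>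

lemma orbit_theta_eq:
  assumes orb: "orbit s = orbit t" and th: "(s, t) \<in> theta S f"
  shows "s = t"
proof -
  have s: "s \<in> S" and t: "t \<in> S" and st: "\<And>z. z \<in> S \<Longrightarrow> z \<cdot> s = z \<cdot> t"
    using th by (auto simp: theta_def)
  have "t \<in> orbit s" using orb orbit_self t by simp
  then obtain x y where xy: "x \<in> S" "y \<in> S" "s \<cdot> x = t \<cdot> y" by (auto simp: orbit_def)
  have "s \<cdot> s \<cdot> x = s \<cdot> t \<cdot> y" using s t xy by (simp add: assoc)
  also have "\<dots> = s \<cdot> s \<cdot> y" using st[OF s] by simp
  finally have "(x, y) \<in> theta S f" using s xy by (intro left_eq_imp_theta[of "s \<cdot> s"]) auto
  then have "t \<cdot> x = t \<cdot> y" using t by (simp add: theta_def)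
  then have "s \<cdot> x = t \<cdot> x" using xy by simp
  then show ?thesis using s t xy cancel by blast
qed

end

section \<open>The embedding\<close>

text \<open>The values of the choice function represent the classes, so that \<open>C \<times> C\<close> is carried by
  pairs of elements of \<open>S\<close>. This keeps \<open>K\<close> no larger than the type of \<open>S\<close>, on which the
  Baer-Levi semigroup lives.\<close>

locale rc_semigroup_choice = rc_semigroup S f
  for S :: "'a set" and f :: "'a \<Rightarrow> 'a \<Rightarrow> 'a" +
  fixes P :: "'a set \<Rightarrow> 'a"
  assumes choice: "choice_function_on (S // theta S f) P"
begin

definition rep :: "'a \<Rightarrow> 'a" where
  "rep s = P (theta S f `` {s})"

definition K :: "('a \<times> 'a) set" where
  "K = rep ` S \<times> rep ` S"

definition K_mult :: "'a \<times> 'a \<Rightarrow> 'a \<times> 'a \<Rightarrow> 'a \<times> 'a" where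
  "K_mult a b = (rep (fst a \<cdot> fst b), snd b)"

lemma rep_theta:
  assumes "s \<in> S"
  shows "(s, rep s) \<in> theta S f"
proof -
  have "theta S f `` {s} \<in> S // theta S f" using assms by (rule quotientI)
  then have "rep s \<in> theta S f `` {s}" using choice by (auto simp: choice_function_on_def rep_def)
  then show ?thesis by simp
qed

lemma rep_closed [simp]: "s \<in> S \<Longrightarrow> rep s \<in> S"
  using rep_theta by (auto simp: theta_def)

lemma rep_eq_iff:
  assumes "s \<in> S" "t \<in> S"
  shows "rep s = rep t \<longleftrightarrow> (s, t) \<in> theta S f"
proof
  assume eq: "rep s = rep t"
  have "(s, rep s) \<in> theta S f" "(t, rep s) \<in> theta S f"
    using rep_theta[OF assms(1)] rep_theta[OF assms(2)] eq by simp_all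
  then show "(s, t) \<in> theta S f" by (auto simp: theta_def)
next
  assume "(s, t) \<in> theta S f"
  then show "rep s = rep t" using equiv_class_eq[OF equiv_theta, of s t S f] by (simp add: rep_def)
qed

lemma rep_mult_rep:
  assumes "s \<in> S" "t \<in> S"
  shows "rep (rep s \<cdot> rep t) = rep (s \<cdot> t)"
proof -
  have "(s \<cdot> t, rep s \<cdot> rep t) \<in> theta S f"
    using theta_congruence[OF semigroup] rep_theta assms by blast
  then show ?thesis using assms by (simp add: rep_eq_iff) (auto simp: theta_def)
qed

lemma class_cases:
  assumes "l \<in> S // theta S f"
  obtains x where "x \<in> S" "l = theta S f `` {x}" "P l = rep x"
  using assms by (auto elim!: quotientE simp: rep_def)

lemma semigroup_K: "semigroup_on K K_mult"
proof -
  have "rep (rep (rep x \<cdot> rep y) \<cdot> rep z) = rep (rep x \<cdot> rep (rep y \<cdot> rep z))"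
    if "x \<in> S" "y \<in> S" "z \<in> S" for x y z
  proof -
    have "rep (rep (rep x \<cdot> rep y) \<cdot> rep z) = rep (x \<cdot> y \<cdot> z)"
      using that by (simp add: rep_mult_rep)
    also have "\<dots> = rep (rep x \<cdot> rep (rep y \<cdot> rep z))"
      using that by (simp add: rep_mult_rep assoc)
    finally show ?thesis .
  qed
  then show ?thesis
    using infinite_carrier by (auto simp: semigroup_on_def K_def K_mult_def)
qed

lemma idempotent_free_K: "idempotent_free_on K K_mult"
proof -
  have "rep (rep x \<cdot> rep x) \<noteq> rep x" if "x \<in> S" for x
    using that square_not_theta by (simp add: rep_mult_rep rep_eq_iff)
  then show ?thesis by (auto simp: idempotent_free_on_def K_def K_mult_def)
qed

lemma left_cancellative_K: "left_cancellative_on K K_mult"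
proof -
  have "b = c" if abc: "a \<in> K" "b \<in> K" "c \<in> K" and eq: "K_mult a b = K_mult a c" for a b c
  proof -
    have "fst a \<in> rep ` S" "fst b \<in> rep ` S" "fst c \<in> rep ` S"
      using abc unfolding K_def by (simp_all add: mem_Times_iff)
    then obtain x y z where xyz: "x \<in> S" "y \<in> S" "z \<in> S"
      and fst_eq: "fst a = rep x" "fst b = rep y" "fst c = rep z"
      by (elim imageE)
    have "rep (x \<cdot> y) = rep (x \<cdot> z)"
      using eq xyz by (simp add: K_mult_def fst_eq rep_mult_rep)
    then have "(y, z) \<in> theta S f"
      using xyz theta_left_cancel[of x y z] by (simp add: rep_eq_iff)
    then show ?thesis
      using eq xyz by (simp add: K_mult_def fst_eq prod_eq_iff rep_eq_iff)
  qed
  then show ?thesis by (auto simp: left_cancellative_on_def)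
qed

text \<open>The sandwich element \<open>P l\<close> is absorbed into the first component: in a product
  \<open>s P(l) t P(m)\<close> the factors then separate as \<open>s P(l)\<close> and \<open>t P(m)\<close>.\<close>

definition to_K :: "'a \<times> 'a set \<Rightarrow> 'a \<times> 'a" where
  "to_K x = (rep (fst x \<cdot> P (snd x)), P (snd x))"

lemma to_K_closed:
  assumes "x \<in> rees_carrier S (S // theta S f)"
  shows "to_K x \<in> K"
proof -
  have "fst x \<in> S" "snd x \<in> S // theta S f" using assms by (auto simp: rees_carrier_def)
  then show ?thesis by (auto elim!: class_cases simp: to_K_def K_def)
qed

lemma to_K_mult:
  assumes "x \<in> rees_carrier S (S // theta S f)" "y \<in> rees_carrier S (S // theta S f)"
  shows "to_K (rees_mult f P x y) = K_mult (to_K x) (to_K y)"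
proof -
  obtain s l t m where xy: "x = (s, l)" "y = (t, m)" by (metis surj_pair)
  have st: "s \<in> S" "t \<in> S" and lm: "l \<in> S // theta S f" "m \<in> S // theta S f"
    using assms by (auto simp: xy rees_carrier_def)
  have "P l \<in> S" "P m \<in> S" using lm by (auto elim!: class_cases)
  then show ?thesis using st by (simp add: xy to_K_def K_mult_def rep_mult_rep assoc)
qed

text \<open>The index is read off from the second component of \<open>to_K\<close>, since distinct classes have
  distinct representatives. Once it is known, it cancels from the first component and leaves the
  class of \<open>s\<close>, which together with the orbit determines \<open>s\<close>.\<close>

lemma to_K_orbit_inj:
  assumes x: "x \<in> rees_carrier S (S // theta S f)" and y: "y \<in> rees_carrier S (S // theta S f)"
    and K_eq: "to_K x = to_K y" and orb: "orbit (fst x) = orbit (fst y)"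
  shows "x = y"
proof -
  obtain s l t m where xy: "x = (s, l)" "y = (t, m)" by (metis surj_pair)
  have st: "s \<in> S" "t \<in> S" and lm: "l \<in> S // theta S f" "m \<in> S // theta S f"
    using x y by (auto simp: xy rees_carrier_def)
  obtain c where c: "c \<in> S" "l = theta S f `` {c}" "P l = rep c" using lm(1) by (rule class_cases)
  obtain d where d: "d \<in> S" "m = theta S f `` {d}" "P m = rep d" using lm(2) by (rule class_cases)
  have eqs: "rep (s \<cdot> rep c) = rep (t \<cdot> rep d)" "rep c = rep d"
    using K_eq by (auto simp: xy to_K_def simp flip: c(3) d(3))
  have "l = m"
    using eqs(2) c d equiv_class_eq[OF equiv_theta, of c d S f] by (simp add: rep_eq_iff)
  moreover have "(s, t) \<in> theta S f"
  proof (rule theta_right_cancel)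
    show "(s \<cdot> rep c, t \<cdot> rep c) \<in> theta S f" 
      using eqs st c d by (simp flip: rep_eq_iff)
  qed (use st c in auto)
  then have "s = t" using orb by (intro orbit_theta_eq) (simp_all add: xy)
  ultimately show ?thesis by (simp add: xy)
qed

lemma orbit_rees_mult:
  assumes "x \<in> rees_carrier S (S // theta S f)" "y \<in> rees_carrier S (S // theta S f)"
  shows "orbit (fst (rees_mult f P x y)) = orbit (fst x)"
proof -
  obtain s l t m where xy: "x = (s, l)" "y = (t, m)" by (metis surj_pair)
  have "s \<in> S" "t \<in> S" "l \<in> S // theta S f" using assms by (auto simp: xy rees_carrier_def)
  then show ?thesis by (auto elim!: class_cases simp: xy orbit_mult)
qed

end

text \<open>Provides the room that \<open>left_cancellative_embeds_baer_levi\<close> needs in order to represent \<open>K\<close>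
  by self-maps of the type of \<open>S\<close>.\<close>

lemma inj_option_triple_of_infinite:
  assumes "infinite (UNIV :: 'a set)"
  shows "\<exists>e :: ('a \<times> 'a) option \<times> 'a \<Rightarrow> 'a. inj e"
proof -
  obtain pair :: "'a \<times> 'a \<Rightarrow> 'a" where pair: "inj pair"
    using card_of_Times_same_infinite[OF assms] card_of_ordIso[of "UNIV \<times> UNIV" "UNIV :: 'a set"]
    by (auto simp: bij_betw_def)
  obtain a b :: 'a where ab: "a \<noteq> b"
    using assms finite_subset[of UNIV "{undefined :: 'a}"] by blast
  \<comment> \<open>The tags \<open>a\<close> and \<open>b\<close> tell \<open>None\<close> from \<open>Some\<close>.\<close>
  define e where "e z = pair
    (case fst z of None \<Rightarrow> pair (a, a) | Some k \<Rightarrow> pair (b, pair k), snd z)" for z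
  have "inj e"
    using ab by (auto intro!: injI simp: e_def inj_eq[OF pair] prod_eq_iff split: option.splits)
  then show ?thesis by blast
qed

theorem corollary1:
  fixes S :: "'a set" and f :: "'a \<Rightarrow> 'a \<Rightarrow> 'a" and P :: "'a set \<Rightarrow> 'a"
  assumes "semigroup_on S f"
    and "idempotent_free_on S f"
    and "right_commutative_on S f"
    and "right_cancellative_on S f"
    and "choice_function_on (S // theta S f) P"
  shows "\<exists>(T :: ('a \<times> 'a set \<Rightarrow> 'a \<times> 'a set) set) g.
    semigroup_on T g \<and> idempotent_free_on T g \<and> left_simple_on T g \<and>
    embeds_in (rees_carrier S (S // theta S f)) (rees_mult f P) T g"
proof -
  interpret rc_semigroup_choice S f P 
    by (intro rc_semigroup_choice.intro rc_semigroup.intro rc_semigroup_choice_axioms.intro assms)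
  let ?M = "rees_carrier S (S // theta S f)"
  have "infinite (UNIV :: 'a set)" using infinite_carrier finite_subset[OF subset_UNIV] by blast
  then obtain e :: "('a \<times> 'a) option \<times> 'a \<Rightarrow> 'a" where e: "inj e"
    using inj_option_triple_of_infinite by blast
  obtain \<psi> :: "'a \<times> 'a \<Rightarrow> 'a \<Rightarrow> 'a" where \<psi>: "\<psi> ` K \<subseteq> baer_levi" "inj_on \<psi> K"
    "\<forall>a\<in>K. \<forall>b\<in>K. \<psi> (K_mult a b) = \<psi> a \<circ> \<psi> b"
    using left_cancellative_embeds_baer_levi[OF e semigroup_K idempotent_free_K
        left_cancellative_K] by blast
  define T :: "('a \<times> 'a set \<Rightarrow> 'a \<times> 'a set) set" where "T = baer_levi_left_zero (orbit ` S)"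
  define \<phi> where "\<phi> x = map_prod (\<psi> (to_K x)) (\<lambda>_ :: 'a set. orbit (fst x))" for x
  obtain s where s: "s \<in> S" using infinite_carrier by fastforce
  then have "\<psi> (rep s, rep s) \<in> baer_levi" using \<psi>(1) by (auto simp: K_def)
  then have "semigroup_on T (\<circ>)"
    unfolding T_def using s by (rule semigroup_baer_levi_left_zero[OF _ imageI])
  moreover have "idempotent_free_on T (\<circ>)"
    unfolding T_def by (rule idempotent_free_baer_levi_left_zero)
  moreover have "left_simple_on T (\<circ>)"
    unfolding T_def
  proof (rule left_simple_baer_levi_left_zero)
    show "inj (\<lambda>w. e (None, w))" "inj (\<lambda>w. e (Some (s, s), w))"
      using e by (auto simp: inj_def)
    show "e (None, x) \<noteq> e (Some (s, s), y)" for x y using e by (simp add: inj_eq)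
  qed
  moreover have "embeds_in ?M (rees_mult f P) T (\<circ>)"
    unfolding embeds_in_def
  proof (intro exI conjI ballI)
    show "\<phi> ` ?M \<subseteq> T"
    proof
      fix u assume "u \<in> \<phi> ` ?M"
      then obtain x where x: "x \<in> ?M" "u = \<phi> x" by blast
      have "\<psi> (to_K x) \<in> baer_levi" using x \<psi>(1) to_K_closed by blast
      moreover have "orbit (fst x) \<in> orbit ` S" using x by (auto simp: rees_carrier_def)
      ultimately show "u \<in> T" unfolding x T_def baer_levi_left_zero_def \<phi>_def by blast
    qed
    show "inj_on \<phi> ?M"
    proof (rule inj_onI)
      fix x y assume xy: "x \<in> ?M" "y \<in> ?M" "\<phi> x = \<phi> y"
      then have "\<psi> (to_K x) = \<psi> (to_K y)" and orb: "orbit (fst x) = orbit (fst y)"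
        by (simp_all add: \<phi>_def map_prod_const_eq_iff)
      then have "to_K x = to_K y" using \<psi>(2) xy to_K_closed by (blast dest: inj_onD)
      then show "x = y" using xy orb by (intro to_K_orbit_inj)
    qed
    show "\<phi> (rees_mult f P x y) = \<phi> x \<circ> \<phi> y" if "x \<in> ?M" "y \<in> ?M" for x y
      using that \<psi>(3) unfolding \<phi>_def comp_map_prod_const
      by (simp add: to_K_mult to_K_closed orbit_rees_mult)
  qed
  ultimately show ?thesis by blast
qed

end
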